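(* Let $M$ be a matroid on a linearly ordered set $E=\{e_1<\dots<e_n\}$ and let $B$ be a basis of $M$. Process $k=1,\dots,n$ in increasing order, declaring each $e_k$ to be "internal" or "external" and assigning a value $\mathrm{Part}(e_k)$ as follows. If $e_k\in B$: - if $e_k\in\mathrm{Int}(B)$, then $e_k$ is internal and $\mathrm{Part}(e_k):=e_k$; - otherwise, if there exists an external $c\in C^*(B;e_k)$ with $c<e_k$, then $e_k$ is external and $\mathrm{Part}(e_k):=\mathrm{Part}(c)$, where $c\in C^*(B;e_k)$, $c<e_k$, is external with $\mathrm{Part}(c)$ the greatest possible; - otherwise, $e_k$ is internal and $\mathrm{Part}(e_k):=\mathrm{Part}(c)$, where $c\in C^*(B;e_k)$, $c<e_k$, has $\mathrm{Part}(c)$ the smallest possible. If $e_k\notin B$: - if $e_k\in\mathrm{Ext}(B)$, then $e_k$ is external and $\mathrm{Part}(e_k):=e_k$; - otherwise, if there exists an internal $c\in C(B;e_k)$ with $c<e_k$, then $e_k$ is internal and $\mathrm{Part}(e_k):=\mathrm{Part}(c)$, where $c\in C(B;e_k)$, $c<e_k$, is internal with $\mathrm{Part}(c)$ the greatest possible; - otherwise, $e_k$ is external and $\mathrm{Part}(e_k):=\mathrm{Part}(c)$, where $c\in C(B;e_k)$, $c<e_k$, has $\mathrm{Part}(c)$ the smallest possible. Then the resulting mapping $\mathrm{Part}:E\to\mathrm{Int}(B)\cup\mathrm{Ext}(B)$ maps each element onto the smallest element of its part in the active partition of $B$, and an element is internal, resp. external, exactly when its image is in $\mathrm{Int}(B)$,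 resp. $\mathrm{Ext}(B)$. Hence the active partition of $B$ is $\biguplus_{e\in\mathrm{Int}(B)\cup\mathrm{Ext}(B)}\mathrm{Part}^{-1}(e)$, with external part $\mathrm{Part}^{-1}(\mathrm{Ext}(B))$. The same holds with the basis $B$ replaced by an arbitrary bipartite graph $\mathcal F$ on $(B,E\setminus B)$.
   Context: For a basis $B$ of $M$: for $b\in B$, $C^*(B;b)$ is the fundamental cocircuit (the unique cocircuit contained in $(E\setminus B)\cup\{b\}$), and for $e\in E\setminus B$, $C(B;e)$ is the fundamental circuit (the unique circuit contained in $B\cup\{e\}$). More generally, for $B\subseteq E$, a bipartite graph $\mathcal F$ on $(B,E\setminus B)$ is a graph with vertex set $E$ all of whose edges join an element of $B$ to an element of $E\setminus B$; then $C^*(B;b)$ is $b$ together with its neighbours, and $C(B;e)$ is $e$ together with its neighbours. (For a matroid basis these notions agree, taking the fundamental graph where $b\in B$ and $e\in E\setminus B$ are adjacent iff $b\in C(B;e)$, equivalently $e\in C^*(B;b)$.) $\mathrm{Int}(B)=\{b\in B: b=\min C^*(B;b)\}$ and $\mathrm{Ext}(B)=\{e\in E\setminus B: e=\min C(B;e)\}$. Active closure. For $b\in B$ let $C^*(B;b)^<=\{e\in C^*(B;b): e<b\}$, and for $e\in E\setminus B$ let $C(B;e)^<=\{b\in C(B;e): b<e\}$. For $X\subseteq\mathrm{Int}(B)$, $\mathrm{acl}(X)$ is the smallest subset of $E$ (for inclusion) such that $X\subseteq\mathrm{acl}(X)$; if $b\in B\cap\mathrm{acl}(X)$ then $C^*(B;b)\subseteq\mathrm{acl}(X)$;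 and if $b\in B$ and $\emptyset\ne C^*(B;b)^<\subseteq\mathrm{acl}(X)$ then $b\in\mathrm{acl}(X)$. For $X\subseteq\mathrm{Ext}(B)$, $\mathrm{acl}(X)$ is the smallest subset of $E$ such that $X\subseteq\mathrm{acl}(X)$; if $e\in (E\setminus B)\cap\mathrm{acl}(X)$ then $C(B;e)\subseteq\mathrm{acl}(X)$; and if $e\in E\setminus B$ and $\emptyset\ne C(B;e)^<\subseteq\mathrm{acl}(X)$ then $e\in\mathrm{acl}(X)$. Active partition. Let $a_1<\dots<a_\iota$ be the elements of $\mathrm{Int}(B)$ and $a'_1<\dots<a'_\varepsilon$ those of $\mathrm{Ext}(B)$. The active filtration is the sequence $\emptyset=F'_\varepsilon\subset\dots\subset F'_0=F_c=F_0\subset\dots\subset F_\iota=E$ with $F_c=\mathrm{acl}(\mathrm{Ext}(B))=E\setminus\mathrm{acl}(\mathrm{Int}(B))$ (these sets are equal), $F_\iota=E$, $F_k=E\setminus\mathrm{acl}(\{a_{k+1},\dots,a_\iota\})$ for $0\le k\le\iota-1$, $F'_\varepsilon=\emptyset$, $F'_k=\mathrm{acl}(\{a'_{k+1},\dots,a'_\varepsilon\})$ for $0\le k\le\varepsilon-1$. The active partition is the partition of $E$ with parts $F'_{k-1}\setminus F'_k$ ($1\le k\le\varepsilon$) and $F_k\setminus F_{k-1}$ ($1\le k\le\iota$). The external part of $E$ is $F_c$. *)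

theory Defs
  imports Main "HOL-Library.Disjoint_Sets" "HOL-Library.FuncSet"
begin

section \<open>Matroids\<close>

text \<open>A matroid on the finite ground set \<open>E\<close>, given by its independent sets.\<close>

definition matroid :: "'a set \<Rightarrow> ('a set \<Rightarrow> bool) \<Rightarrow> bool" where
  "matroid E indep \<longleftrightarrow>
     finite E \<and>
     (\<forall>X. indep X \<longrightarrow> X \<subseteq> E) \<and>
     indep {} \<and>
     (\<forall>X Y. indep X \<and> Y \<subseteq> X \<longrightarrow> indep Y) \<and>
     (\<forall>X Y. indep X \<and> indep Y \<and> card X < card Y \<longrightarrow> (\<exists>y \<in> Y - X. indep (insert y X)))"

definition basis :: "('a set \<Rightarrow> bool) \<Rightarrow> 'a set \<Rightarrow> bool" where
  "basis indep B \<longleftrightarrow> indep B \<and> (\<forall>X. indep X \<and> B \<subseteq> X \<longrightarrow> X = B)"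

definition circuit :: "'a set \<Rightarrow> ('a set \<Rightarrow> bool) \<Rightarrow> 'a set \<Rightarrow> bool" where
  "circuit E indep C \<longleftrightarrow> C \<subseteq> E \<and> \<not> indep C \<and> (\<forall>D. D \<subset> C \<longrightarrow> indep D)"

text \<open>Independent sets of the dual matroid: the subsets of complements of bases.\<close>

definition dual_indep :: "'a set \<Rightarrow> ('a set \<Rightarrow> bool) \<Rightarrow> 'a set \<Rightarrow> bool" where
  "dual_indep E indep X \<longleftrightarrow> (\<exists>B. basis indep B \<and> X \<subseteq> E - B)"

definition cocircuit :: "'a set \<Rightarrow> ('a set \<Rightarrow> bool) \<Rightarrow> 'a set \<Rightarrow> bool" where
  "cocircuit E indep = circuit E (dual_indep E indep)"

definition fund_circuit :: "'a set \<Rightarrow> ('a set \<Rightarrow> bool) \<Rightarrow> 'a set \<Rightarrow> 'a \<Rightarrow> 'a set" where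
  "fund_circuit E indep B e = (THE C. circuit E indep C \<and> C \<subseteq> B \<union> {e})"

definition fund_cocircuit :: "'a set \<Rightarrow> ('a set \<Rightarrow> bool) \<Rightarrow> 'a set \<Rightarrow> 'a \<Rightarrow> 'a set" where
  "fund_cocircuit E indep B b = (THE D. cocircuit E indep D \<and> D \<subseteq> (E - B) \<union> {b})"


section \<open>Bipartite graphs on \<open>(B, E - B)\<close>\<close>

text \<open>A graph with vertex set \<open>E\<close> is given by its set \<open>G\<close> of edges, each a two-element set.\<close>

definition bipartite_graph :: "'a set \<Rightarrow> 'a set \<Rightarrow> 'a set set \<Rightarrow> bool" where
  "bipartite_graph E B G \<longleftrightarrow>
     finite E \<and> B \<subseteq> E \<and> (\<forall>X \<in> G. \<exists>b \<in> B. \<exists>e \<in> E - B. X = {b, e})"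

text \<open>A vertex together with its neighbours: \<open>C*(B;b)\<close> for \<open>b \<in> B\<close> and
  \<open>C(B;e)\<close> for \<open>e \<in> E - B\<close>.\<close>

definition closed_nbhd :: "'a set set \<Rightarrow> 'a \<Rightarrow> 'a set" where
  "closed_nbhd G v = {v} \<union> {w. {v, w} \<in> G}"


section \<open>Activities and active closure\<close>

text \<open>The notions below depend on \<open>E\<close>, \<open>B\<close> and the families \<open>Cs b = C*(B;b)\<close>
  (\<open>b \<in> B\<close>) and \<open>C e = C(B;e)\<close> (\<open>e \<in> E - B\<close>) only, so they cover both matroid bases
  and bipartite graphs. The linear order on \<open>E\<close> is that of the type class.\<close>

definition IntAct :: "'a::linorder set \<Rightarrow> ('a \<Rightarrow> 'a set) \<Rightarrow> 'a set" where
  "IntAct B Cs = {b \<in> B. b = Min (Cs b)}"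

definition ExtAct :: "'a::linorder set \<Rightarrow> 'a set \<Rightarrow> ('a \<Rightarrow> 'a set) \<Rightarrow> 'a set" where
  "ExtAct E B C = {e \<in> E - B. e = Min (C e)}"

text \<open>The family intersected below contains \<open>E\<close> and is closed under intersections,
  so its intersection is its smallest member.\<close>

definition acl :: "'a::linorder set \<Rightarrow> 'a set \<Rightarrow> ('a \<Rightarrow> 'a set) \<Rightarrow> 'a set \<Rightarrow> 'a set" where
  "acl E S D X = \<Inter>{A. A \<subseteq> E \<and> X \<subseteq> A \<and>
     (\<forall>s \<in> S. s \<in> A \<longrightarrow> D s \<subseteq> A) \<and>
     (\<forall>s \<in> S. {c \<in> D s. c < s} \<noteq> {} \<and> {c \<in> D s. c < s} \<subseteq> A \<longrightarrow> s \<in> A)}"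

definition int_acl :: "'a::linorder set \<Rightarrow> 'a set \<Rightarrow> ('a \<Rightarrow> 'a set) \<Rightarrow> 'a set \<Rightarrow> 'a set" where
  "int_acl E B Cs X = acl E B Cs X"

definition ext_acl :: "'a::linorder set \<Rightarrow> 'a set \<Rightarrow> ('a \<Rightarrow> 'a set) \<Rightarrow> 'a set \<Rightarrow> 'a set" where
  "ext_acl E B C X = acl E (E - B) C X"


section \<open>Active filtration and active partition\<close>

text \<open>\<open>F\<^sub>k\<close> and \<open>F'\<^sub>k\<close>. For \<open>Int(B) = {a\<^sub>1 < \<dots> < a\<^sub>\<iota>}\<close>,
  \<open>drop k\<close> of the sorted list is \<open>[a\<^bsub>k+1\<^esub>, \<dots>, a\<^sub>\<iota>]\<close>; likewise for \<open>Ext(B)\<close>.\<close>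

definition int_filt :: "'a::linorder set \<Rightarrow> 'a set \<Rightarrow> ('a \<Rightarrow> 'a set) \<Rightarrow> nat \<Rightarrow> 'a set" where
  "int_filt E B Cs k =
     (if k = card (IntAct B Cs) then E
      else E - int_acl E B Cs (set (drop k (sorted_list_of_set (IntAct B Cs)))))"

definition ext_filt :: "'a::linorder set \<Rightarrow> 'a set \<Rightarrow> ('a \<Rightarrow> 'a set) \<Rightarrow> nat \<Rightarrow> 'a set" where
  "ext_filt E B C k =
     (if k = card (ExtAct E B C) then {}
      else ext_acl E B C (set (drop k (sorted_list_of_set (ExtAct E B C)))))"

definition active_partition ::
  "'a::linorder set \<Rightarrow> 'a set \<Rightarrow> ('a \<Rightarrow> 'a set) \<Rightarrow> ('a \<Rightarrow> 'a set) \<Rightarrow> 'a set set" where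
  "active_partition E B Cs C =
     {ext_filt E B C (k - 1) - ext_filt E B C k | k. 1 \<le> k \<and> k \<le> card (ExtAct E B C)} \<union>
     {int_filt E B Cs k - int_filt E B Cs (k - 1) | k. 1 \<le> k \<and> k \<le> card (IntAct B Cs)}"

text \<open>The set \<open>F\<^sub>c = acl(Ext(B))\<close> of the filtration.\<close>

definition external_part :: "'a::linorder set \<Rightarrow> 'a set \<Rightarrow> ('a \<Rightarrow> 'a set) \<Rightarrow> 'a set" where
  "external_part E B C = ext_acl E B C (ExtAct E B C)"


section \<open>The single-pass algorithm\<close>

datatype status = Internal | External

text \<open>A state records the status and the value of \<open>Part\<close> for the elements processed so far.\<close>

type_synonym 'a state = "'a \<Rightarrow> (status \<times> 'a) option"

definition smaller_values :: "'a::linorder state \<Rightarrow> 'a set \<Rightarrow> 'a \<Rightarrow> 'a set" where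
  "smaller_values \<sigma> D e = {p. \<exists>c \<in> D. c < e \<and> (\<exists>s. \<sigma> c = Some (s, p))}"

definition smaller_values_with :: "status \<Rightarrow> 'a::linorder state \<Rightarrow> 'a set \<Rightarrow> 'a \<Rightarrow> 'a set" where
  "smaller_values_with s \<sigma> D e = {p. \<exists>c \<in> D. c < e \<and> \<sigma> c = Some (s, p)}"

definition process ::
  "'a::linorder set \<Rightarrow> 'a set \<Rightarrow> ('a \<Rightarrow> 'a set) \<Rightarrow> ('a \<Rightarrow> 'a set) \<Rightarrow> 'a \<Rightarrow> 'a state \<Rightarrow> 'a state" where
  "process E B Cs C e \<sigma> = \<sigma>(e \<mapsto>
     (if e \<in> B then
        if e \<in> IntAct B Cs then (Internal, e)
        else if \<exists>c \<in> Cs e. c < e \<and> (\<exists>p. \<sigma> c = Some (External, p))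
          then (External, Max (smaller_values_with External \<sigma> (Cs e) e))
        else (Internal, Min (smaller_values \<sigma> (Cs e) e))
      else
        if e \<in> ExtAct E B C then (External, e)
        else if \<exists>c \<in> C e. c < e \<and> (\<exists>p. \<sigma> c = Some (Internal, p))
          then (Internal, Max (smaller_values_with Internal \<sigma> (C e) e))
        else (External, Min (smaller_values \<sigma> (C e) e))))"

definition final_state ::
  "'a::linorder set \<Rightarrow> 'a set \<Rightarrow> ('a \<Rightarrow> 'a set) \<Rightarrow> ('a \<Rightarrow> 'a set) \<Rightarrow> 'a state" where
  "final_state E B Cs C = fold (process E B Cs C) (sorted_list_of_set E) Map.empty"

definition status_of ::
  "'a::linorder set \<Rightarrow> 'a set \<Rightarrow> ('a \<Rightarrow> 'a set) \<Rightarrow> ('a \<Rightarrow> 'a set) \<Rightarrow> 'a \<Rightarrow> status" where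
  "status_of E B Cs C e = fst (the (final_state E B Cs C e))"

definition Part ::
  "'a::linorder set \<Rightarrow> 'a set \<Rightarrow> ('a \<Rightarrow> 'a set) \<Rightarrow> ('a \<Rightarrow> 'a set) \<Rightarrow> 'a \<Rightarrow> 'a" where
  "Part E B Cs C e = snd (the (final_state E B Cs C e))"

end

theory Submission
  imports Defs
begin

text \<open>
  Exchanging \<open>B\<close> with \<open>E - B\<close>, \<open>C*\<close> with \<open>C\<close> and internal with external preserves both the
  hypotheses and the recursion of the algorithm, so it suffices to treat internal elements.
  For an up-set \<open>X\<close> of \<open>Int(B)\<close>, the internal elements with \<open>Part\<close> in \<open>X\<close> are exactly
  \<open>acl(X)\<close>: an internal \<open>b \<in> B\<close> takes the minimum over its smaller neighbours, which are all
  internal, and an internal \<open>e \<notin> B\<close> takes the maximum over its smaller internal neighbours;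
  the minimum matches the rule
  ``all smaller neighbours in \<open>acl(X)\<close>'', the maximum the rule
  ``some neighbour in \<open>acl(X)\<close>''. The parts of the filtration are then the fibres of \<open>Part\<close>.
\<close>

section \<open>Duality and fundamental circuits\<close>

lemma circuit_in_exists:
  assumes "finite X" "X \<subseteq> E" "\<not> indep X"
  shows "\<exists>K \<subseteq> X. circuit E indep K"
proof -
  let ?F = "{Y. Y \<subseteq> X \<and> \<not> indep Y}"
  have "finite ?F" "X \<in> ?F" using assms by auto
  from finite_has_minimal2[OF this]
  obtain K where K: "K \<subseteq> X" "\<not> indep K" "\<And>Y. Y \<subseteq> X \<Longrightarrow> \<not> indep Y \<Longrightarrow> Y \<subseteq> K \<Longrightarrow> K = Y"
    by auto
  have "indep Y" if "Y \<subset> K" for Y using K(1) K(3)[of Y] that by auto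
  then have "circuit E indep K" unfolding circuit_def using assms(2) K(1,2) by auto
  then show ?thesis using K(1) by auto
qed

locale finite_matroid =
  fixes E :: "'a set" and indep :: "'a set \<Rightarrow> bool"
  assumes matroid: "matroid E indep"
begin

section \<open>Independent sets and bases of a matroid\<close>

lemma finite_ground: "finite E"
  and indep_subset_ground: "indep X \<Longrightarrow> X \<subseteq> E"
  and indep_mono: "indep X \<Longrightarrow> Y \<subseteq> X \<Longrightarrow> indep Y"
  and indep_augment: "indep X \<Longrightarrow> indep Y \<Longrightarrow> card X < card Y \<Longrightarrow> \<exists>y \<in> Y - X. indep (insert y X)"
  and indep_empty: "indep {}"
  using matroid unfolding matroid_def by blast+

lemma indep_finite: "indep X \<Longrightarrow> finite X"
  using finite_ground finite_subset indep_subset_ground by blast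

text \<open>Iterated augmentation. The bound \<open>Z \<subseteq> X \<union> Y\<close> is kept
  because the applications must know where the added elements come from.\<close>

lemma indep_extend:
  assumes "indep X" "indep Y" "card X \<le> card Y"
  shows "\<exists>Z. indep Z \<and> X \<subseteq> Z \<and> Z \<subseteq> X \<union> Y \<and> card Z = card Y"
  using assms
proof (induction "card Y - card X" arbitrary: X)
  case 0
  then show ?case by (intro exI[of _ X]) auto
next
  case (Suc n)
  then have "card X < card Y" by linarith
  then obtain y where y: "y \<in> Y - X" "indep (insert y X)"
    using indep_augment[OF Suc.prems(1,2)] by blast
  have "card (insert y X) = Suc (card X)" using y Suc.prems indep_finite by auto
  then have "n = card Y - card (insert y X)" "card (insert y X) \<le> card Y"
    using Suc.hyps(2) by linarith+
  from Suc.hyps(1)[OF this(1) y(2) Suc.prems(2) this(2)]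
  obtain Z where "indep Z" "insert y X \<subseteq> Z" "Z \<subseteq> insert y X \<union> Y" "card Z = card Y"
    by blast
  then show ?case using y(1) by blast
qed

lemma indep_card_le_basis:
  assumes "indep X" "basis indep B"
  shows "card X \<le> card B"
proof (rule ccontr)
  assume "\<not> card X \<le> card B"
  then obtain y where "y \<in> X - B" "indep (insert y B)"
    using indep_augment[of B X] assms unfolding basis_def by auto
  then show False using assms(2) unfolding basis_def by blast
qed

lemma basis_iff_card:
  assumes "basis indep B"
  shows "basis indep X \<longleftrightarrow> indep X \<and> card X = card B"
proof
  assume X: "basis indep X"
  then have "indep X" "indep B" using assms unfolding basis_def by auto
  then show "indep X \<and> card X = card B"
    using indep_card_le_basis[OF _ assms] indep_card_le_basis[OF _ X] by (meson le_antisym)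
next
  assume X: "indep X \<and> card X = card B"
  have "Y = X" if "indep Y" "X \<subseteq> Y" for Y
    using card_seteq[of Y X] indep_card_le_basis[OF that(1) assms] indep_finite that X by auto
  then show "basis indep X" using X unfolding basis_def by blast
qed

lemma basis_exists: "\<exists>B. basis indep B"
proof -
  have "finite {X. indep X}"
    by (rule finite_subset[of _ "Pow E"]) (auto simp: finite_ground dest: indep_subset_ground)
  then obtain B where "indep B" "\<And>Y. indep Y \<Longrightarrow> B \<subseteq> Y \<Longrightarrow> B = Y"
    using finite_has_maximal2[of "{X. indep X}" "{}"] indep_empty by auto
  then show ?thesis unfolding basis_def by blast
qed

text \<open>A circuit inside \<open>B \<union> {e}\<close> must contain \<open>e\<close>, and
  exchange determines the rest. If \<open>b\<close> is in the circuit, removing it leaves an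
  independent set that extends inside \<open>B \<union> {e}\<close> to the size of \<open>B\<close>
  without regaining \<open>b\<close>; counting forces the exchanged set. If \<open>b\<close> is not
  in it, the circuit lies in the exchanged set, which is then dependent. So the \<open>THE\<close>
  is well defined, with a membership test that \<open>fund_cocircuit_eq\<close> will share.\<close>

lemma fund_circuit_eq:
  assumes B: "basis indep B" and e: "e \<in> E - B"
  shows "fund_circuit E indep B e = insert e {b \<in> B. indep (insert e (B - {b}))}"
proof -
  let ?K = "insert e {b \<in> B. indep (insert e (B - {b}))}"
  have iB: "indep B" using B unfolding basis_def by blast
  have unique: "X = ?K" if X: "circuit E indep X" "X \<subseteq> B \<union> {e}" for X
  proof -
    have dep: "\<not> indep X" and min: "\<And>Y. Y \<subset> X \<Longrightarrow> indep Y"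
      using X(1) unfolding circuit_def by auto
    have eX: "e \<in> X" using dep indep_mono[OF iB] X(2) by blast
    have "indep (insert e (B - {b}))" if b: "b \<in> X" "b \<in> B" for b
    proof -
      have "indep (X - {b})" using min b(1) by blast
      then obtain Z where Z: "indep Z" "X - {b} \<subseteq> Z" "Z \<subseteq> (X - {b}) \<union> B" "card Z = card B"
        using indep_extend[OF _ iB] indep_card_le_basis[OF _ B] by meson
      have "b \<notin> Z"
      proof
        assume "b \<in> Z"
        then have "X \<subseteq> Z" using Z(2) by blast
        then show False using dep indep_mono Z(1) by blast
      qed
      then have sub: "Z \<subseteq> insert e (B - {b})" using Z(3) X(2) by blast
      have "0 < card B" using b(2) indep_finite[OF iB] card_gt_0_iff by blast
      then have "card (insert e (B - {b})) = card B"
        using b(2) e indep_finite[OF iB] by simp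
      then have "Z = insert e (B - {b})"
        using card_subset_eq[OF _ sub] Z(4) indep_finite[OF iB] by simp
      then show ?thesis using Z(1) by simp
    qed
    moreover have "b \<in> X" if b: "b \<in> B" "indep (insert e (B - {b}))" for b
    proof (rule ccontr)
      assume "b \<notin> X"
      then have "X \<subseteq> insert e (B - {b})" using X(2) by blast
      then show False using dep indep_mono b(2) by blast
    qed
    ultimately show ?thesis using eX X(2) by blast
  qed
  have "\<not> indep (insert e B)" using B e unfolding basis_def by blast
  moreover have "insert e B \<subseteq> E" "finite (insert e B)"
    using e iB indep_subset_ground indep_finite by auto
  ultimately obtain K where K: "circuit E indep K" "K \<subseteq> B \<union> {e}"
    using circuit_in_exists[of "insert e B" E indep] by auto
  show ?thesis unfolding fund_circuit_def
    by (rule the_equality) (use unique K in auto)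
qed

text \<open>The work is in augmentation. With \<open>X\<close> avoiding a basis \<open>B1\<close>
  and \<open>Y\<close> avoiding a basis \<open>B2\<close>, complete \<open>B2 - X\<close> by
  elements of \<open>B1\<close> to a basis \<open>Z\<close>. Then \<open>Z\<close> misses
  \<open>X\<close>, so any element of \<open>Y - X\<close> outside \<open>Z\<close> can be added to
  \<open>X\<close>, with \<open>Z\<close> as the witness.\<close>

lemma dual_matroid: "finite_matroid E (dual_indep E indep)"
proof -
  have "\<exists>y \<in> Y - X. dual_indep E indep (insert y X)"
    if XY: "dual_indep E indep X" "dual_indep E indep Y" "card X < card Y" for X Y
  proof -
    obtain B1 where B1: "basis indep B1" "X \<subseteq> E - B1"
      using XY unfolding dual_indep_def by blast
    obtain B2 where B2: "basis indep B2" "Y \<subseteq> E - B2"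
      using XY unfolding dual_indep_def by blast
    have ind: "indep B1" "indep B2" using B1 B2 unfolding basis_def by auto
    have fin: "finite X" "finite Y" "finite B2"
      using B1 B2 finite_ground finite_subset ind indep_finite by blast+
    have "indep (B2 - X)" using indep_mono ind(2) by blast
    then obtain Z where Z: "indep Z" "B2 - X \<subseteq> Z" "Z \<subseteq> (B2 - X) \<union> B1" "card Z = card B1"
      using indep_extend[OF _ ind(1)] indep_card_le_basis[OF _ B1(1)] by meson
    \<comment> \<open>Otherwise \<open>Z\<close> contains the disjoint sets \<open>Y - X\<close> and
      \<open>B2 - X\<close>. As \<open>Y\<close> avoids \<open>B2\<close>, the set
      \<open>X \<inter> B2\<close> lies in \<open>X - Y\<close>, which is smaller than
      \<open>Y - X\<close>; hence \<open>Z\<close> would be larger than \<open>B2\<close>.\<close>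
    have "\<not> Y - X \<subseteq> Z"
    proof
      assume "Y - X \<subseteq> Z"
      then have "card ((Y - X) \<union> (B2 - X)) \<le> card Z"
        using Z(1,2) by (intro card_mono indep_finite) auto
      moreover have "card ((Y - X) \<union> (B2 - X)) = card (Y - X) + card (B2 - X)"
        using fin B2(2) by (intro card_Un_disjoint) auto
      moreover have "card (X - Y) < card (Y - X)"
        using XY(3) fin by (simp add: card_less_sym_Diff)
      moreover have "card (X \<inter> B2) \<le> card (X - Y)"
        using fin B2(2) by (intro card_mono) auto
      moreover have "card B2 = card (X \<inter> B2) + card (B2 - X)"
        using card_Int_Diff[OF fin(3), of X] by (simp add: Int_commute)
      moreover have "card B2 = card B1" using B2 basis_iff_card[OF B1(1)] by blast
      ultimately show False using Z(4) by linarith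
    qed
    then obtain y where y: "y \<in> Y - X" "y \<notin> Z" by blast
    have "basis indep Z" using basis_iff_card[OF B1(1)] Z by blast
    moreover have "insert y X \<subseteq> E - Z" using y B1 B2 Z(3) by blast
    ultimately show ?thesis using y unfolding dual_indep_def by blast
  qed
  moreover have "dual_indep E indep {}" using basis_exists unfolding dual_indep_def by blast
  moreover have "dual_indep E indep Y" if "dual_indep E indep X" "Y \<subseteq> X" for X Y
    using that unfolding dual_indep_def by blast
  moreover have "X \<subseteq> E" if "dual_indep E indep X" for X
    using that unfolding dual_indep_def by blast
  ultimately show ?thesis unfolding finite_matroid_def matroid_def
    using finite_ground by blast
qed

lemma dual_basis:
  assumes B: "basis indep B"
  shows "basis (dual_indep E indep) (E - B)"
proof -
  have "X = E - B" if X: "dual_indep E indep X" "E - B \<subseteq> X" for X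
  proof -
    obtain B' where B': "basis indep B'" "X \<subseteq> E - B'"
      using X(1) unfolding dual_indep_def by blast
    have "B' \<subseteq> B" using B' X(2) indep_subset_ground unfolding basis_def by blast
    then have "B' = B" using B B' unfolding basis_def by blast
    then show ?thesis using B' X by blast
  qed
  then show ?thesis using B unfolding basis_def dual_indep_def by blast
qed

text \<open>The two sets are complements of each other in \<open>E\<close>. A basis avoiding the
  first lies in the second and has the same cardinality, so it equals the second.\<close>

lemma dual_indep_exchange_iff:
  assumes B: "basis indep B" and b: "b \<in> B" and e: "e \<in> E - B"
  shows "dual_indep E indep (insert b (E - B - {e})) \<longleftrightarrow> indep (insert e (B - {b}))"
proof -
  have iB: "indep B" "B \<subseteq> E" using B indep_subset_ground unfolding basis_def by auto
  have "0 < card B" using b indep_finite[OF iB(1)] card_gt_0_iff by blast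
  then have card: "card (insert e (B - {b})) = card B" using b e indep_finite[OF iB(1)] by simp
  show ?thesis
  proof
    assume "dual_indep E indep (insert b (E - B - {e}))"
    then obtain B' where B': "basis indep B'" "insert b (E - B - {e}) \<subseteq> E - B'"
      unfolding dual_indep_def by blast
    have "B' \<subseteq> E" using B' indep_subset_ground unfolding basis_def by blast
    then have "B' \<subseteq> insert e (B - {b})" using B' by blast
    moreover have "card B' = card B" "indep B'" using B' basis_iff_card[OF B] by auto
    ultimately show "indep (insert e (B - {b}))"
      using card_subset_eq[of "insert e (B - {b})" B'] card indep_finite[OF iB(1)] by simp
  next
    assume "indep (insert e (B - {b}))"
    then have "basis indep (insert e (B - {b}))" using card basis_iff_card[OF B] by blast
    moreover have "insert b (E - B - {e}) \<subseteq> E - insert e (B - {b})" using b e iB by blast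
    ultimately show "dual_indep E indep (insert b (E - B - {e}))"
      unfolding dual_indep_def by blast
  qed
qed

text \<open>This is \<open>fund_circuit_eq\<close> in the dual matroid, with the exchange condition
  carried back. The condition is the one found for circuits, which makes adjacency readable from
  either end.\<close>

lemma fund_cocircuit_eq:
  assumes B: "basis indep B" and b: "b \<in> B"
  shows "fund_cocircuit E indep B b = insert b {e \<in> E - B. indep (insert e (B - {b}))}"
proof -
  interpret dual: finite_matroid E "dual_indep E indep" by (rule dual_matroid)
  have "b \<in> E - (E - B)" using B b indep_subset_ground unfolding basis_def by blast
  from dual.fund_circuit_eq[OF dual_basis[OF B] this]
  show ?thesis
    using dual_indep_exchange_iff[OF B b]
    unfolding fund_cocircuit_def fund_circuit_def cocircuit_def by auto
qed

end


section \<open>Labellings and active closures\<close>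

definition smaller_in :: "('a::linorder \<Rightarrow> 'a set) \<Rightarrow> 'a \<Rightarrow> 'a set" where
  "smaller_in D x = {c \<in> D x. c < x}"

lemma smaller_in_iff [iff]: "c \<in> smaller_in D x \<longleftrightarrow> c \<in> D x \<and> c < x"
  unfolding smaller_in_def by simp

text \<open>Common ground of matroid bases and bipartite graphs: a bipartite graph presented by the
  closed neighbourhoods on its two sides. The assumptions are invariant under swapping the sides,
  which \<open>dual\<close> records.\<close>

locale fundamental_pair =
  fixes E B :: "'a::linorder set" and Cs C :: "'a \<Rightarrow> 'a set"
  assumes finite_ground: "finite E"
    and basis_subset: "B \<subseteq> E"
    and cocircuit_self: "b \<in> B \<Longrightarrow> b \<in> Cs b"
    and circuit_self: "e \<in> E - B \<Longrightarrow> e \<in> C e"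
    and cocircuit_subset: "b \<in> B \<Longrightarrow> Cs b \<subseteq> insert b (E - B)"
    and circuit_subset: "e \<in> E - B \<Longrightarrow> C e \<subseteq> insert e B"
    and adjacent_iff: "b \<in> B \<Longrightarrow> e \<in> E - B \<Longrightarrow> e \<in> Cs b \<longleftrightarrow> b \<in> C e"
begin

lemma double_diff: "E - (E - B) = B"
  using basis_subset by blast

lemma dual: "fundamental_pair E (E - B) C Cs"
  by unfold_locales
    (use finite_ground cocircuit_self circuit_self cocircuit_subset circuit_subset adjacent_iff
      in \<open>auto simp: double_diff\<close>)

lemma smaller_in_cocircuit: "b \<in> B \<Longrightarrow> smaller_in Cs b \<subseteq> E - B"
  using cocircuit_subset by fastforce

lemma smaller_in_circuit: "e \<in> E - B \<Longrightarrow> smaller_in C e \<subseteq> B"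
  using circuit_subset by fastforce

lemma finite_cocircuit: "b \<in> B \<Longrightarrow> finite (Cs b)"
  using cocircuit_subset finite_ground by (meson finite.insertI finite_Diff finite_subset)

lemma IntAct_eq: "IntAct B Cs = {b \<in> B. smaller_in Cs b = {}}"
proof -
  have "b = Min (Cs b) \<longleftrightarrow> smaller_in Cs b = {}" if "b \<in> B" for b
    using eq_Min_iff[OF finite_cocircuit[OF that], of b] cocircuit_self[OF that] by force
  then show ?thesis unfolding IntAct_def by blast
qed

lemma ExtAct_eq_dual: "ExtAct E B C = IntAct (E - B) C"
  unfolding ExtAct_def IntAct_def ..

end

text \<open>The recursion of the algorithm as equations between final labels, free of states. The
  predicate \<open>own\<close> is read as internal, and as external after dualizing. Active elements
  fit the two rules for \<open>own\<close>, since over an empty set the universal one holds and the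
  existential one fails.\<close>

locale labelling = fundamental_pair E B Cs C
  for E B :: "'a::linorder set" and Cs C :: "'a \<Rightarrow> 'a set" +
  fixes own :: "'a \<Rightarrow> bool" and part :: "'a \<Rightarrow> 'a"
  assumes own_basis: "b \<in> B \<Longrightarrow> own b \<longleftrightarrow> (\<forall>c \<in> smaller_in Cs b. own c)"
    and own_cobasis: "e \<in> E - B \<Longrightarrow> own e \<longleftrightarrow> (\<exists>c \<in> smaller_in C e. own c)"
    and part_active_basis: "b \<in> B \<Longrightarrow> smaller_in Cs b = {} \<Longrightarrow> part b = b"
    and part_active_cobasis: "e \<in> E - B \<Longrightarrow> smaller_in C e = {} \<Longrightarrow> part e = e"
    and part_basis_own:
      "b \<in> B \<Longrightarrow> own b \<Longrightarrow> smaller_in Cs b \<noteq> {} \<Longrightarrow> part b = Min (part ` smaller_in Cs b)"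
    and part_basis_other:
      "b \<in> B \<Longrightarrow> \<not> own b \<Longrightarrow> part b = Max (part ` {c \<in> smaller_in Cs b. \<not> own c})"
    and part_cobasis_own:
      "e \<in> E - B \<Longrightarrow> own e \<Longrightarrow> part e = Max (part ` {c \<in> smaller_in C e. own c})"
    and part_cobasis_other:
      "e \<in> E - B \<Longrightarrow> \<not> own e \<Longrightarrow> smaller_in C e \<noteq> {} \<Longrightarrow> part e = Min (part ` smaller_in C e)"
begin

text \<open>Negating \<open>own\<close> exchanges the universal with the existential rule and the
  own with the other clauses. The eight assumptions thus form four dual pairs, and each goal is the
  partner of its assumption.\<close>

lemma dual_labelling: "labelling E (E - B) C Cs (\<lambda>x. \<not> own x) part"
proof (rule labelling.intro[OF dual], rule labelling_axioms.intro, unfold double_diff not_not, goal_cases)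
  case (1 e) then show ?case using own_cobasis[of e] by auto
next
  case (2 b) then show ?case using own_basis[of b] by auto
next
  case (3 e) then show ?case by (rule part_active_cobasis)
next
  case (4 b) then show ?case by (rule part_active_basis)
next
  case (5 e) then show ?case by (rule part_cobasis_other)
next
  case (6 e) then show ?case by (rule part_cobasis_own)
next
  case (7 b) then show ?case by (rule part_basis_other)
next
  case (8 b) then show ?case by (rule part_basis_own)
qed

section \<open>Labels along edges\<close>

lemma finite_smaller: "b \<in> B \<Longrightarrow> finite (smaller_in Cs b)" "e \<in> E - B \<Longrightarrow> finite (smaller_in C e)"
  using smaller_in_cocircuit smaller_in_circuit finite_ground basis_subset
  by (meson finite_Diff finite_subset)+

lemma finite_smaller_own: "e \<in> E - B \<Longrightarrow> finite {c \<in> smaller_in C e. own c}"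
  by (rule finite_subset[OF _ finite_smaller(2)]) blast+

text \<open>Together with \<open>part_cobasis_ge\<close> this shows that passing from an own element
  of \<open>B\<close> to a neighbour outside \<open>B\<close> keeps \<open>own\<close> and never
  lowers \<open>part\<close>: the minimum gives this if the neighbour comes earlier, the maximum if
  it comes later.\<close>

lemma part_basis_le:
  assumes "b \<in> B" "own b" "c \<in> smaller_in Cs b"
  shows "own c" "part b \<le> part c"
proof -
  show "own c" using own_basis assms by blast
  have "part b = Min (part ` smaller_in Cs b)" using part_basis_own assms by blast
  then show "part b \<le> part c" using assms finite_smaller(1) by (simp add: Min_le)
qed

lemma part_cobasis_ge:
  assumes "e \<in> E - B" "c \<in> smaller_in C e" "own c"
  shows "own e" "part c \<le> part e"
proof -
  show own: "own e" using own_cobasis assms by blast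
  show "part c \<le> part e"
    unfolding part_cobasis_own[OF assms(1) own]
    using assms finite_smaller_own[OF assms(1)] by (intro Max_ge finite_imageI imageI) auto
qed

lemma part_basis_attained:
  assumes "b \<in> B" "own b" "smaller_in Cs b \<noteq> {}"
  shows "\<exists>c \<in> smaller_in Cs b. own c \<and> part b = part c"
proof -
  have "part b \<in> part ` smaller_in Cs b"
    unfolding part_basis_own[OF assms] using assms finite_smaller(1) by (intro Min_in) auto
  then show ?thesis using part_basis_le(1)[OF assms(1,2)] by blast
qed

lemma part_cobasis_attained:
  assumes "e \<in> E - B" "own e"
  shows "\<exists>c \<in> smaller_in C e. own c \<and> part e = part c"
proof -
  have "{c \<in> smaller_in C e. own c} \<noteq> {}" using assms own_cobasis by blast
  then have "part e \<in> part ` {c \<in> smaller_in C e. own c}"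
    unfolding part_cobasis_own[OF assms]
    using finite_smaller_own[OF assms(1)] by (intro Max_in finite_imageI) auto
  then show ?thesis by blast
qed

text \<open>Induction along the assignment of labels. In \<open>B\<close> the minimum runs over all
  smaller neighbours, so the hypothesis is offered for each of them; outside \<open>B\<close> it is
  offered for one own neighbour attaining the maximum.\<close>

lemma own_induct [consumes 2, case_names active basis cobasis]:
  assumes "x \<in> E" "own x"
    and active: "\<And>b. b \<in> IntAct B Cs \<Longrightarrow> P b"
    and basis: "\<And>b. b \<in> B \<Longrightarrow> own b \<Longrightarrow> smaller_in Cs b \<noteq> {} \<Longrightarrow>
      (\<And>c. c \<in> smaller_in Cs b \<Longrightarrow> P c) \<Longrightarrow> P b"
    and cobasis: "\<And>e c. e \<in> E - B \<Longrightarrow> c \<in> B \<Longrightarrow> c \<in> smaller_in C e \<Longrightarrow> own c \<Longrightarrow>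
      part e = part c \<Longrightarrow> P c \<Longrightarrow> P e"
  shows "P x"
proof -
  have "x \<in> E \<and> own x \<longrightarrow> P x"
  \<comment> \<open>The order of the type need not be well-founded, so the position of
    \<open>x\<close> in the finite set \<open>E\<close> serves as the measure.\<close>
  proof (induction "card {c \<in> E. c < x}" arbitrary: x rule: less_induct)
    case less
    have IH: "P c" if "c \<in> E" "own c" "c < x" for c
    proof -
      have "{d \<in> E. d < c} \<subset> {d \<in> E. d < x}" using that by auto
      then show ?thesis using less that finite_ground by (simp add: psubset_card_mono)
    qed
    show ?case
    proof
      assume x: "x \<in> E \<and> own x"
      show "P x"
      proof (cases "x \<in> B")
        case True
        have "P c" if "c \<in> smaller_in Cs x" for c
          using IH[of c] part_basis_le(1)[OF True _ that] smaller_in_cocircuit[OF True] x that by blast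
        then show ?thesis using active[of x] basis[of x] True x by (auto simp: IntAct_eq)
      next
        case False
        then obtain c where c: "c \<in> smaller_in C x" "own c" "part x = part c"
          using part_cobasis_attained x by blast
        then have "c \<in> B" using smaller_in_circuit[of x] False x by blast
        then show ?thesis using cobasis[of x c] IH[of c] c False x basis_subset by blast
      qed
    qed
  qed
  then show ?thesis using assms by blast
qed

lemma own_active: "a \<in> IntAct B Cs \<Longrightarrow> own a \<and> part a = a"
  using own_basis part_active_basis unfolding IntAct_eq by blast

text \<open>Every label is copied from a smaller own element, so tracing it back descends to an
  active element of \<open>B\<close>. The bound \<open>part x \<le> x\<close> later makes that
  element the minimum of its fibre.\<close>

lemma own_part_active: "x \<in> E \<Longrightarrow> own x \<Longrightarrow> part x \<in> IntAct B Cs \<and> part x \<le> x"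
proof (induction rule: own_induct)
  case (active b)
  then show ?case using own_active by simp
next
  case (basis b)
  then obtain c where "c \<in> smaller_in Cs b" "part b = part c"
    using part_basis_attained by blast
  then show ?case using basis.IH[of c] by auto
next
  case (cobasis e c)
  then show ?case by auto
qed

text \<open>The right-hand side satisfies the closure rules because labels never drop from
  \<open>B\<close> to neighbours outside it and \<open>X\<close> is an up-set, and because a minimum
  over smaller neighbours is attained at one of them. It lies in every set satisfying the rules by
  \<open>own_induct\<close>.\<close>

lemma acl_eq:
  assumes X: "X \<subseteq> IntAct B Cs" and up: "\<And>a a'. a \<in> X \<Longrightarrow> a' \<in> IntAct B Cs \<Longrightarrow> a \<le> a' \<Longrightarrow> a' \<in> X"
  shows "acl E B Cs X = {x \<in> E. own x \<and> part x \<in> X}"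
proof -
  let ?U = "{x \<in> E. own x \<and> part x \<in> X}"
  have "IntAct B Cs \<subseteq> E" using basis_subset unfolding IntAct_eq by blast
  then have XU: "X \<subseteq> ?U" using X own_active by auto
  have upU: "y \<in> ?U" if "x \<in> ?U" "y \<in> E" "own y" "part x \<le> part y" for x y
    using up[of "part x" "part y"] own_part_active[of y] that by simp
  have nbrs: "Cs b \<subseteq> ?U" if b: "b \<in> B" "b \<in> ?U" for b
  proof
    fix e assume e: "e \<in> Cs b"
    consider "e = b" | "e \<in> E - B" "e < b" | "e \<in> E - B" "b < e"
      using cocircuit_subset[OF b(1)] e b(1) by (cases e b rule: linorder_cases) auto
    then show "e \<in> ?U"
    proof cases
      case 2
      then show ?thesis using part_basis_le[OF b(1), of e] upU[OF b(2), of e] b(2) e by simp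
    next
      case 3
      then have "b \<in> smaller_in C e" using adjacent_iff[OF b(1)] e by simp
      then show ?thesis using part_cobasis_ge[of e b] upU[OF b(2), of e] b(2) 3 by simp
    qed (use b in simp)
  qed
  have lower: "b \<in> ?U" if b: "b \<in> B" "smaller_in Cs b \<noteq> {}" "smaller_in Cs b \<subseteq> ?U" for b
  proof -
    have own: "own b" using own_basis[OF b(1)] b(3) by blast
    then show ?thesis using part_basis_attained[OF b(1) own b(2)] b basis_subset by auto
  qed
  have least: "?U \<subseteq> A"
    if A: "X \<subseteq> A" "\<forall>s \<in> B. s \<in> A \<longrightarrow> Cs s \<subseteq> A"
      "\<forall>s \<in> B. smaller_in Cs s \<noteq> {} \<and> smaller_in Cs s \<subseteq> A \<longrightarrow> s \<in> A" for A
  proof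
    fix x assume "x \<in> ?U"
    then have "x \<in> E" "own x" "part x \<in> X" by auto
    then show "x \<in> A"
    proof (induction rule: own_induct)
      case (active b)
      then show ?case using own_active A(1) by auto
    next
      case (basis b)
      \<comment> \<open>The label of \<open>b\<close> is the minimum, so the label of
        \<open>c\<close> is at least as large and stays in the up-set \<open>X\<close>; the
        induction hypothesis then applies to \<open>c\<close>.\<close>
      have "c \<in> A" if c: "c \<in> smaller_in Cs b" for c
      proof -
        have "c \<in> E" using smaller_in_cocircuit basis c by blast
        then have "part c \<in> IntAct B Cs" "part b \<le> part c"
          using part_basis_le[OF basis(1,2) c] own_part_active by auto
        then show ?thesis using basis c up by blast
      qed
      then show ?case using A(3) basis by blast
    next
      case (cobasis e c)
      then have "c \<in> A" "e \<in> Cs c" using adjacent_iff by auto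
      then show ?case using A(2) cobasis by blast
    qed
  qed
  show ?thesis
    unfolding acl_def smaller_in_def[symmetric]
  proof (rule equalityI)
    show "{x \<in> E. own x \<and> part x \<in> X} \<subseteq> \<Inter> {A. A \<subseteq> E \<and> X \<subseteq> A \<and> (\<forall>s \<in> B. s \<in> A \<longrightarrow> Cs s \<subseteq> A) \<and>
        (\<forall>s \<in> B. smaller_in Cs s \<noteq> {} \<and> smaller_in Cs s \<subseteq> A \<longrightarrow> s \<in> A)}"
      by (rule Inter_greatest) (rule least; simp)
  qed (rule Inter_lower, use XU nbrs lower in simp)
qed

lemma acl_drop:
  defines "as \<equiv> sorted_list_of_set (IntAct B Cs)"
  shows "acl E B Cs (set (drop k as)) = {x \<in> E. own x \<and> part x \<in> set (drop k as)}"
proof (rule acl_eq)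
  have "finite (IntAct B Cs)"
    using finite_subset[OF basis_subset finite_ground] unfolding IntAct_eq by simp
  then have as: "set as = IntAct B Cs" "sorted as"
    unfolding as_def by auto
  then show "set (drop k as) \<subseteq> IntAct B Cs" using set_drop_subset by metis
  fix a a' assume a: "a \<in> set (drop k as)" "a' \<in> IntAct B Cs" "a \<le> a'"
  have "a' \<in> set (take k as) \<union> set (drop k as)"
    using a(2) as(1) by (metis append_take_drop_id set_append)
  moreover have "\<forall>x \<in> set (take k as). \<forall>y \<in> set (drop k as). x \<le> y"
    using as(2) by (metis append_take_drop_id sorted_append)
  \<comment> \<open>If \<open>a'\<close> were in the initial segment, it would also be at most
    \<open>a\<close>, hence equal to \<open>a\<close>.\<close>
  ultimately show "a' \<in> set (drop k as)" using a by force
qed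

text \<open>Consecutive final segments of the sorted active elements differ in one element, so by
  \<open>acl_drop\<close> the difference of their closures is the fibre over it.\<close>

lemma filtration_parts:
  defines "as \<equiv> sorted_list_of_set (IntAct B Cs)"
  shows "{acl E B Cs (set (drop (k - 1) as)) - acl E B Cs (set (drop k as)) | k.
      1 \<le> k \<and> k \<le> card (IntAct B Cs)} = {{x \<in> E. own x \<and> part x = a} | a. a \<in> IntAct B Cs}"
    (is "?L = ?R")
proof -
  have "finite (IntAct B Cs)"
    using finite_subset[OF basis_subset finite_ground] unfolding IntAct_eq by simp
  then have as: "set as = IntAct B Cs" "distinct as" "length as = card (IntAct B Cs)"
    unfolding as_def by auto
  have layer: "acl E B Cs (set (drop i as)) - acl E B Cs (set (drop (Suc i) as))
      = {x \<in> E. own x \<and> part x = as ! i}" if i: "i < length as" for i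
  proof -
    have d: "drop i as = as ! i # drop (Suc i) as" using i by (simp add: Cons_nth_drop_Suc)
    have "set (drop i as) = insert (as ! i) (set (drop (Suc i) as))"
      using arg_cong[OF d, of set] by simp
    moreover have "as ! i \<notin> set (drop (Suc i) as)"
      using arg_cong[OF d, of distinct] as(2) by simp
    ultimately show ?thesis unfolding acl_drop[folded as_def] by auto
  qed
  \<comment> \<open>The index \<open>k\<close> starts at 1 while list positions start at 0; writing
    \<open>k = Suc i\<close> matches layer \<open>k\<close> with \<open>as ! i\<close>.\<close>
  have "?L = (\<lambda>k. acl E B Cs (set (drop (k - 1) as)) - acl E B Cs (set (drop k as))) ` (Suc ` {..<length as})"
    unfolding as(3)[symmetric] image_Suc_lessThan by (auto simp only: atLeastAtMost_iff image_def)
  also have "\<dots> = (\<lambda>i. acl E B Cs (set (drop i as)) - acl E B Cs (set (drop (Suc i) as))) ` {..<length as}"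
    by (simp add: image_image)
  also have "\<dots> = (\<lambda>i. {x \<in> E. own x \<and> part x = as ! i}) ` {..<length as}"
    using layer by (intro image_cong) auto
  also have "\<dots> = (\<lambda>a. {x \<in> E. own x \<and> part x = a}) ` ((!) as ` {..<length as})"
    by (simp add: image_image)
  also have "(!) as ` {..<length as} = IntAct B Cs"
    unfolding as(1)[symmetric] by (auto simp: set_conv_nth)
  finally show ?thesis by blast
qed

end


section \<open>The single-pass algorithm\<close>

text \<open>In an increasing pass the entry at \<open>x\<close> depends on entries below
  \<open>x\<close>, and these are final when \<open>x\<close> is reached. Hence the final state
  satisfies the recursion itself, and intermediate states can be forgotten.\<close>

lemma fold_fun_upd_fixpoint:
  fixes f :: "'a::linorder \<Rightarrow> ('a \<Rightarrow> 'b) \<Rightarrow> 'b"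
  assumes local: "\<And>e \<sigma> \<tau>. (\<And>c. c < e \<Longrightarrow> \<sigma> c = \<tau> c) \<Longrightarrow> f e \<sigma> = f e \<tau>"
    and "sorted_wrt (<) xs" "x \<in> set xs"
  shows "fold (\<lambda>e \<sigma>. \<sigma>(e := f e \<sigma>)) xs \<sigma> x = f x (fold (\<lambda>e \<sigma>. \<sigma>(e := f e \<sigma>)) xs \<sigma>)"
  using assms(2,3)
proof (induction xs arbitrary: x rule: rev_induct)
  case (snoc y xs)
  define \<tau> where "\<tau> = fold (\<lambda>e \<sigma>. \<sigma>(e := f e \<sigma>)) xs \<sigma>"
  have upd: "fold (\<lambda>e \<sigma>. \<sigma>(e := f e \<sigma>)) (xs @ [y]) \<sigma> = \<tau>(y := f y \<tau>)"
    unfolding \<tau>_def by (simp only: fold_append fold.simps comp_apply id_apply)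
  have IH: "\<tau> x = f x \<tau>" if "x \<in> set xs"
    unfolding \<tau>_def by (rule snoc.IH) (use snoc.prems that in \<open>simp_all add: sorted_wrt_append\<close>)
  consider "x = y" | "x \<in> set xs" "x < y" using snoc.prems by (auto simp: sorted_wrt_append)
  then have "x \<le> y" and upd_x: "(\<tau>(y := f y \<tau>)) x = f x \<tau>"
    using IH by (cases; auto)+
  \<comment> \<open>As \<open>x \<le> y\<close>, the update at \<open>y\<close> changes nothing
    below \<open>x\<close>.\<close>
  then have "f x \<tau> = f x (\<tau>(y := f y \<tau>))"
    by (intro local) auto
  with upd_x show ?case unfolding upd by (rule trans)
qed simp

lemma process_local:
  assumes "\<And>c. c < e \<Longrightarrow> \<sigma> c = \<tau> c"
  shows "process E B Cs C e \<sigma> e = process E B Cs C e \<tau> e"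
proof -
  have vals: "smaller_values \<sigma> D e = smaller_values \<tau> D e"
    "smaller_values_with s \<sigma> D e = smaller_values_with s \<tau> D e"
    "(\<exists>c \<in> D. c < e \<and> (\<exists>p. \<sigma> c = Some (s, p))) \<longleftrightarrow>
      (\<exists>c \<in> D. c < e \<and> (\<exists>p. \<tau> c = Some (s, p)))" for s D
    unfolding smaller_values_def smaller_values_with_def
    by (simp_all add: assms cong: conj_cong)
  show ?thesis unfolding process_def vals by (simp only: fun_upd_same)
qed

lemma final_state_fixpoint:
  assumes "finite E" "e \<in> E"
  shows "final_state E B Cs C e = process E B Cs C e (final_state E B Cs C) e"
proof -
  \<comment> \<open>A processing step changes its own entry alone, which gives it the shape required
    by \<open>fold_fun_upd_fixpoint\<close>.\<close>
  have "process E B Cs C = (\<lambda>e \<sigma>. \<sigma>(e := process E B Cs C e \<sigma> e))"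
    unfolding process_def by (simp only: fun_upd_same)
  then have final: "final_state E B Cs C =
      fold (\<lambda>e \<sigma>. \<sigma>(e := process E B Cs C e \<sigma> e)) (sorted_list_of_set E) Map.empty"
    unfolding final_state_def by (rule arg_cong)
  show ?thesis
    unfolding final
    by (rule fold_fun_upd_fixpoint[where f = "\<lambda>e \<sigma>. process E B Cs C e \<sigma> e"], rule process_local)
      (use assms in simp_all)
qed

section \<open>The final state as a labelling\<close>

context fundamental_pair
begin

abbreviation "internal x \<equiv> status_of E B Cs C x = Internal"

abbreviation "final_part \<equiv> Part E B Cs C"

lemma final_state_eq_Some:
  assumes "x \<in> E"
  shows "final_state E B Cs C x = Some (status_of E B Cs C x, final_part x)"
  using final_state_fixpoint[OF finite_ground assms, of B Cs C]
  unfolding status_of_def Part_def by (simp add: process_def)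

text \<open>Every element of \<open>E\<close> has an entry in the final state, so lookups there
  become statements about \<open>status_of\<close> and \<open>Part\<close>.\<close>

lemma smaller_values_final:
  assumes "smaller_in D x \<subseteq> E"
  shows "smaller_values (final_state E B Cs C) (D x) x = final_part ` smaller_in D x"
    and "smaller_values_with s (final_state E B Cs C) (D x) x
      = final_part ` {c \<in> smaller_in D x. status_of E B Cs C c = s}"
    and "(\<exists>c \<in> D x. c < x \<and> (\<exists>p. final_state E B Cs C c = Some (s, p)))
      \<longleftrightarrow> (\<exists>c \<in> smaller_in D x. status_of E B Cs C c = s)"
proof -
  have eq: "final_state E B Cs C c = Some (status_of E B Cs C c, final_part c)"
    if "c \<in> D x" "c < x" for c
    using final_state_eq_Some assms that by blast
  show "smaller_values (final_state E B Cs C) (D x) x = final_part ` smaller_in D x"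
    unfolding smaller_values_def using eq by force
  show "smaller_values_with s (final_state E B Cs C) (D x) x
      = final_part ` {c \<in> smaller_in D x. status_of E B Cs C c = s}"
    unfolding smaller_values_with_def using eq by force
  show "(\<exists>c \<in> D x. c < x \<and> (\<exists>p. final_state E B Cs C c = Some (s, p)))
      \<longleftrightarrow> (\<exists>c \<in> smaller_in D x. status_of E B Cs C c = s)"
    using eq by force
qed

lemma final_basis:
  assumes "b \<in> B"
  shows "(status_of E B Cs C b, final_part b) =
    (if smaller_in Cs b = {} then (Internal, b)
     else if \<exists>c \<in> smaller_in Cs b. \<not> internal c
       then (External, Max (final_part ` {c \<in> smaller_in Cs b. \<not> internal c}))
     else (Internal, Min (final_part ` smaller_in Cs b)))"
proof -
  have ext: "status_of E B Cs C c = External \<longleftrightarrow> \<not> internal c" for c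
    by (cases "status_of E B Cs C c") auto
  have act: "b \<in> IntAct B Cs \<longleftrightarrow> smaller_in Cs b = {}" using assms unfolding IntAct_eq by blast
  have sub: "smaller_in Cs b \<subseteq> E" and b: "b \<in> E" using smaller_in_cocircuit basis_subset assms by auto
  note vals = smaller_values_final[where D = Cs and x = b, OF sub]
  have "Some (status_of E B Cs C b, final_part b) = process E B Cs C b (final_state E B Cs C) b"
    using final_state_fixpoint[OF finite_ground b] final_state_eq_Some[OF b] by metis
  then show ?thesis unfolding process_def vals act ext using assms by simp
qed

lemma final_cobasis:
  assumes "e \<in> E - B"
  shows "(status_of E B Cs C e, final_part e) =
    (if smaller_in C e = {} then (External, e)
     else if \<exists>c \<in> smaller_in C e. internal c
       then (Internal, Max (final_part ` {c \<in> smaller_in C e. internal c}))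
     else (External, Min (final_part ` smaller_in C e)))"
proof -
  have act: "e \<in> ExtAct E B C \<longleftrightarrow> smaller_in C e = {}"
    using assms fundamental_pair.IntAct_eq[OF dual] unfolding ExtAct_eq_dual by blast
  have sub: "smaller_in C e \<subseteq> E" and e: "e \<in> E" using smaller_in_circuit basis_subset assms by auto
  note vals = smaller_values_final[where D = C and x = e, OF sub]
  have "Some (status_of E B Cs C e, final_part e) = process E B Cs C e (final_state E B Cs C) e"
    using final_state_fixpoint[OF finite_ground e] final_state_eq_Some[OF e] by metis
  then show ?thesis unfolding process_def vals act using assms by simp
qed

lemma final_labelling: "labelling E B Cs C (\<lambda>x. internal x) final_part"
proof (rule labelling.intro[OF fundamental_pair_axioms], unfold_locales, goal_cases)
  case (1 b) then show ?case using final_basis[of b] by (auto split: if_splits)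
next
  case (2 e) then show ?case using final_cobasis[of e] by (auto split: if_splits)
next
  case (3 b) then show ?case using final_basis[of b] by simp
next
  case (4 e) then show ?case using final_cobasis[of e] by simp
next
  case (5 b) then show ?case using final_basis[of b] by (simp split: if_splits)
next
  case (6 b) then show ?case using final_basis[of b] by (simp split: if_splits)
next
  case (7 e) then show ?case using final_cobasis[of e] by (simp split: if_splits)
next
  case (8 e) then show ?case using final_cobasis[of e] by (simp split: if_splits)
qed

text \<open>The results on labellings are applied twice, to the internal elements and, through
  \<open>dual_labelling\<close>, to the external ones. Both families of layers then become fibres of
  \<open>Part\<close>.\<close>

lemma active_partition_correct:
  shows "final_part \<in> E \<rightarrow> IntAct B Cs \<union> ExtAct E B C \<and>
         partition_on E (active_partition E B Cs C) \<and>
         (\<forall>P \<in> active_partition E B Cs C. \<forall>e \<in> P. final_part e = Min P) \<and>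
         (\<forall>e \<in> E. (status_of E B Cs C e = Internal \<longleftrightarrow> final_part e \<in> IntAct B Cs) \<and>
                  (status_of E B Cs C e = External \<longleftrightarrow> final_part e \<in> ExtAct E B C)) \<and>
         active_partition E B Cs C =
           {{x \<in> E. final_part x = e} | e. e \<in> IntAct B Cs \<union> ExtAct E B C} \<and>
         external_part E B C = {x \<in> E. final_part x \<in> ExtAct E B C}"
proof -
  interpret I: labelling E B Cs C "\<lambda>x. internal x" final_part by (rule final_labelling)
  interpret X: labelling E "E - B" C Cs "\<lambda>x. \<not> internal x" final_part by (rule I.dual_labelling)
  let ?I = "IntAct B Cs" and ?X = "ExtAct E B C" and ?\<A> = "active_partition E B Cs C"
  let ?is = "sorted_list_of_set ?I" and ?xs = "sorted_list_of_set ?X"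
  note Xeq = ExtAct_eq_dual[symmetric]
  have disj: "?I \<inter> ?X = {}" unfolding IntAct_def ExtAct_def by blast
  have sub: "?I \<union> ?X \<subseteq> E" using basis_subset unfolding IntAct_def ExtAct_def by blast
  \<comment> \<open>Internal elements have labels in Int(B) and external ones in Ext(B); as these
    sets are disjoint, the label determines the status.\<close>
  have int: "internal x \<longleftrightarrow> final_part x \<in> ?I" and ext: "\<not> internal x \<longleftrightarrow> final_part x \<in> ?X"
    and le: "final_part x \<le> x" if "x \<in> E" for x
    using I.own_part_active[OF that] X.own_part_active[OF that] disj unfolding Xeq by blast+
  have fixed: "final_part a = a" if "a \<in> ?I \<union> ?X" for a
    using I.own_active X.own_active that unfolding Xeq by blast
  \<comment> \<open>The separate clause at \<open>k = card\<close> agrees with the general one: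
    there \<open>drop\<close> leaves the empty list, whose closure is empty by
    \<open>acl_drop\<close>. The same holds for \<open>int_filt\<close>, whose value is then
    \<open>E\<close>.\<close>
  have ext_filt: "ext_filt E B C k = acl E (E - B) C (set (drop k ?xs))" for k
    using X.acl_drop[of k] unfolding ext_filt_def ext_acl_def Xeq by simp
  have int_filt: "int_filt E B Cs k = E - acl E B Cs (set (drop k ?is))" for k
    using I.acl_drop[of k] unfolding int_filt_def int_acl_def by simp
  have acl_sub: "acl E B Cs (set (drop k ?is)) \<subseteq> E" for k
    using I.acl_drop[of k] by auto
  \<comment> \<open>Complementation in \<open>E\<close> reverses the difference, so both filtrations
    have layers of the form treated in \<open>filtration_parts\<close>.\<close>
  have int_layer: "int_filt E B Cs k - int_filt E B Cs (k - 1)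
      = acl E B Cs (set (drop (k - 1) ?is)) - acl E B Cs (set (drop k ?is))" for k
    using acl_sub[of "k - 1"] unfolding int_filt by blast
  have "?\<A> = {{x \<in> E. \<not> internal x \<and> final_part x = a} | a. a \<in> ?X}
      \<union> {{x \<in> E. internal x \<and> final_part x = a} | a. a \<in> ?I}"
    unfolding active_partition_def int_layer I.filtration_parts[symmetric]
      X.filtration_parts[symmetric, unfolded Xeq] ext_filt ..
  also have "\<dots> = (\<lambda>a. {x \<in> E. \<not> internal x \<and> final_part x = a}) ` ?X
      \<union> (\<lambda>a. {x \<in> E. internal x \<and> final_part x = a}) ` ?I" by blast
  also have "(\<lambda>a. {x \<in> E. \<not> internal x \<and> final_part x = a}) ` ?X
      = (\<lambda>a. {x \<in> E. final_part x = a}) ` ?X" using ext by (intro image_cong) auto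
  also have "(\<lambda>a. {x \<in> E. internal x \<and> final_part x = a}) ` ?I
      = (\<lambda>a. {x \<in> E. final_part x = a}) ` ?I" using int by (intro image_cong) auto
  finally have \<A>: "?\<A> = {{x \<in> E. final_part x = a} | a. a \<in> ?I \<union> ?X}" by blast
  have range: "final_part x \<in> ?I \<union> ?X" if "x \<in> E" for x using int[OF that] ext[OF that] by blast
  have part: "partition_on E ?\<A>"
  proof (rule partition_onI)
    show "\<Union> ?\<A> = E" unfolding \<A> using range by auto
    show "disjnt P Q" if "P \<in> ?\<A>" "Q \<in> ?\<A>" "P \<noteq> Q" for P Q
      using that unfolding \<A> disjnt_def by auto
    \<comment> \<open>Each active element is fixed by \<open>Part\<close>, so it lies in its own
      fibre.\<close>
    show "{} \<notin> ?\<A>"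
    proof
      assume "{} \<in> ?\<A>"
      then obtain a where a: "a \<in> ?I \<union> ?X" "{} = {x \<in> E. final_part x = a}"
        unfolding \<A> by blast
      then have "a \<in> {x \<in> E. final_part x = a}" using sub fixed[OF a(1)] by blast
      then show False unfolding a(2)[symmetric] by simp
    qed
  qed
  have min: "final_part e = Min P" if P: "P \<in> ?\<A>" "e \<in> P" for P e
  proof -
    obtain a where a: "a \<in> ?I \<union> ?X" and P_eq: "P = {x \<in> E. final_part x = a}"
      using P(1) unfolding \<A> by blast
    have "a \<in> E" "final_part a = a" using a sub fixed[OF a] by blast+
    then have "Min P = a"
      unfolding P_eq using finite_ground le by (intro Min_eqI) auto
    then show ?thesis using P_eq P(2) by simp
  qed
  \<comment> \<open>The full set Ext(B) is trivially an up-set of itself, so the dual of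
    \<open>acl_eq\<close> applies.\<close>
  have "acl E (E - B) C ?X = {x \<in> E. \<not> internal x \<and> final_part x \<in> ?X}"
    unfolding ExtAct_eq_dual by (rule X.acl_eq) auto
  then have "external_part E B C = {x \<in> E. final_part x \<in> ?X}"
    unfolding external_part_def ext_acl_def using ext by auto
  moreover have "status_of E B Cs C e = External \<longleftrightarrow> \<not> internal e" for e
    by (cases "status_of E B Cs C e") auto
  ultimately show ?thesis
    using part min range int ext by (intro conjI ballI Pi_I \<A>) auto
qed

end

section \<open>Matroid bases and bipartite graphs as fundamental pairs\<close>

lemma basis_fundamental_pair:
  fixes B :: "'a::linorder set"
  assumes "matroid E indep" "basis indep B"
  shows "fundamental_pair E B (fund_cocircuit E indep B) (fund_circuit E indep B)"
proof -
  interpret finite_matroid E indep by unfold_locales (rule assms)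
  \<comment> \<open>By the two exchange descriptions, both sides of \<open>adjacent_iff\<close>
    amount to \<open>indep (insert e (B - {b}))\<close>.\<close>
  show ?thesis
    using assms finite_ground indep_subset_ground
    by unfold_locales (auto simp: fund_circuit_eq fund_cocircuit_eq basis_def)
qed

lemma bipartite_graph_fundamental_pair:
  assumes "bipartite_graph E B G"
  shows "fundamental_pair E B (closed_nbhd G) (closed_nbhd G)"
proof
  \<comment> \<open>Edges are unordered pairs, so either vertex may be the one in
    \<open>B\<close>.\<close>
  have G: "v \<in> B \<and> w \<in> E - B \<or> v \<in> E - B \<and> w \<in> B" if "{v, w} \<in> G" for v w
    using assms that unfolding bipartite_graph_def by (fastforce simp: doubleton_eq_iff)
  show "closed_nbhd G b \<subseteq> insert b (E - B)" if "b \<in> B" for b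
    using G that unfolding closed_nbhd_def by blast
  show "closed_nbhd G e \<subseteq> insert e B" if "e \<in> E - B" for e
    using G that unfolding closed_nbhd_def by blast
qed (use assms in \<open>auto simp: closed_nbhd_def bipartite_graph_def insert_commute\<close>)

theorem proposition4p29:
  fixes E B :: "'a::linorder set" and Cs C :: "'a \<Rightarrow> 'a set"
  assumes "(\<exists>indep. matroid E indep \<and> basis indep B \<and>
              Cs = fund_cocircuit E indep B \<and> C = fund_circuit E indep B) \<or>
           (\<exists>G. bipartite_graph E B G \<and> Cs = closed_nbhd G \<and> C = closed_nbhd G)"
  shows "Part E B Cs C \<in> E \<rightarrow> IntAct B Cs \<union> ExtAct E B C \<and>
         partition_on E (active_partition E B Cs C) \<and>
         (\<forall>P \<in> active_partition E B Cs C. \<forall>e \<in> P. Part E B Cs C e = Min P) \<and>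
         (\<forall>e \<in> E. (status_of E B Cs C e = Internal \<longleftrightarrow> Part E B Cs C e \<in> IntAct B Cs) \<and>
                  (status_of E B Cs C e = External \<longleftrightarrow> Part E B Cs C e \<in> ExtAct E B C)) \<and>
         active_partition E B Cs C =
           {{x \<in> E. Part E B Cs C x = e} | e. e \<in> IntAct B Cs \<union> ExtAct E B C} \<and>
         external_part E B C = {x \<in> E. Part E B Cs C x \<in> ExtAct E B C}"
proof -
  have "fundamental_pair E B Cs C"
    using assms basis_fundamental_pair bipartite_graph_fundamental_pair by blast
  then show ?thesis by (rule fundamental_pair.active_partition_correct)
qed

end
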